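(* Let $\theta=\{k_r\}_{r\in\mathbb{N}\cup\{0\}}$ be a lacunary sequence and let $0<\alpha\leq\beta\leq 1$. Then $PN_{\theta}^{\alpha}\subset PS_{\theta}^{\beta}$. This inclusion is strict whenever $\alpha<\beta$.
   Context: A lacunary sequence is an increasing sequence of integers $\theta=\{k_r\}_{r\in\mathbb{N}\cup\{0\}}$ with $k_0=0$ and $h_r:=k_r-k_{r-1}\to\infty$ as $r\to\infty$. Put $I_r=(k_{r-1},k_r]$ (sums and cardinalities over $k\in I_r$ range over integers $k$). $|A|$ denotes the cardinality of a finite set $A$. All random variables in a sequence, together with its limit, are defined on a common probability space $(S,\triangle,P)$. For $0<\alpha\le1$, a sequence of random variables $\{X_n\}_{n\in\mathbb{N}}$ is $S_\theta$-convergent (lacunary statistically convergent) of order $\alpha$ in probability to a random variable $X$ if for all $\varepsilon,\delta>0$, $\lim_{r\to\infty}\frac{1}{h_r^{\alpha}}|\{k\in I_r: P(|X_k-X|\ge\varepsilon)\ge\delta\}|=0$. $PS_\theta^{\alpha}$ denotes the class of all sequences of random variables which are $S_\theta$-convergent of order $\alpha$ in probability (to some random variable). For $0<\alpha\le1$, $\{X_n\}_{n\in\mathbb{N}}$ is $N_\theta$-convergent of order $\alpha$ in probability to a random variable $X$ if for every $\varepsilon>0$, $\lim_{r\to\infty}\frac{1}{h_r^{\alpha}}\sum_{k\in I_r}P(|X_k-X|\ge\varepsilon)=0$. $PN_\theta^{\alpha}$ denotes the class of all sequences of random variables which are $N_\theta$-convergent of order $\alpha$ in probability (to some random variable). The symbol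 $\subset$ denotes inclusion, not necessarily proper. *)

theory Defs
  imports "HOL-Probability.Probability"
begin

text \<open>An increasing integer sequence starting at 0 is non-negative, so its values are
  taken in \<^typ>\<open>nat\<close>. The index \<open>r\<close> of blocks starts at 1; the values at \<open>r = 0\<close>
  of the two functions below are degenerate and do not affect limits.\<close>

definition block_length :: "(nat \<Rightarrow> nat) \<Rightarrow> nat \<Rightarrow> nat" where
  "block_length \<theta> r = \<theta> r - \<theta> (r - 1)"

definition block :: "(nat \<Rightarrow> nat) \<Rightarrow> nat \<Rightarrow> nat set" where
  "block \<theta> r = {\<theta> (r - 1)<..\<theta> r}"

definition lacunary :: "(nat \<Rightarrow> nat) \<Rightarrow> bool" where
  "lacunary \<theta> \<longleftrightarrow> strict_mono \<theta> \<and> \<theta> 0 = 0 \<and> filterlim (block_length \<theta>) at_top sequentially"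

text \<open>Sequences of random variables are indexed by \<open>n \<ge> 1\<close>; the value \<open>X 0\<close> is
  unconstrained and lies in no block.\<close>

definition rv_sequence :: "'a measure \<Rightarrow> (nat \<Rightarrow> 'a \<Rightarrow> real) \<Rightarrow> bool" where
  "rv_sequence M X \<longleftrightarrow> (\<forall>n\<ge>1. X n \<in> borel_measurable M)"

definition S_convergent_in_prob ::
  "'a measure \<Rightarrow> (nat \<Rightarrow> nat) \<Rightarrow> real \<Rightarrow> (nat \<Rightarrow> 'a \<Rightarrow> real) \<Rightarrow> ('a \<Rightarrow> real) \<Rightarrow> bool" where
  "S_convergent_in_prob M \<theta> \<alpha> X Y \<longleftrightarrow>
     (\<forall>\<epsilon>>0. \<forall>\<delta>>0.
        (\<lambda>r. 1 / real (block_length \<theta> r) powr \<alpha> *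
             real (card {k \<in> block \<theta> r. \<P>(x in M. \<bar>X k x - Y x\<bar> \<ge> \<epsilon>) \<ge> \<delta>}))
          \<longlonglongrightarrow> 0)"

definition N_convergent_in_prob ::
  "'a measure \<Rightarrow> (nat \<Rightarrow> nat) \<Rightarrow> real \<Rightarrow> (nat \<Rightarrow> 'a \<Rightarrow> real) \<Rightarrow> ('a \<Rightarrow> real) \<Rightarrow> bool" where
  "N_convergent_in_prob M \<theta> \<alpha> X Y \<longleftrightarrow>
     (\<forall>\<epsilon>>0.
        (\<lambda>r. 1 / real (block_length \<theta> r) powr \<alpha> *
             (\<Sum>k\<in>block \<theta> r. \<P>(x in M. \<bar>X k x - Y x\<bar> \<ge> \<epsilon>)))
          \<longlonglongrightarrow> 0)"

definition PS :: "'a measure \<Rightarrow> (nat \<Rightarrow> nat) \<Rightarrow> real \<Rightarrow> (nat \<Rightarrow> 'a \<Rightarrow> real) set" where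
  "PS M \<theta> \<alpha> = {X. rv_sequence M X \<and>
     (\<exists>Y \<in> borel_measurable M. S_convergent_in_prob M \<theta> \<alpha> X Y)}"

definition PN :: "'a measure \<Rightarrow> (nat \<Rightarrow> nat) \<Rightarrow> real \<Rightarrow> (nat \<Rightarrow> 'a \<Rightarrow> real) set" where
  "PN M \<theta> \<alpha> = {X. rv_sequence M X \<and>
     (\<exists>Y \<in> borel_measurable M. N_convergent_in_prob M \<theta> \<alpha> X Y)}"

end

theory Submission
  imports Defs "HOL-Real_Asymp.Real_Asymp"
begin

text \<open>The inclusion is Markov's inequality for the counting measure on a block, together with
  \<open>h powr \<alpha> \<le> h powr \<beta>\<close> for \<open>h \<ge> 1\<close>. Strictness already holds for constant random variables: let
  \<open>X k = 1\<close> on the first \<open>m = \<lceil>h powr \<alpha>\<rceil>\<close> indices of each block of length \<open>h\<close> and \<open>X k = 0\<close> on the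
  others. Since \<open>m / h powr \<beta>\<close> tends to \<open>0\<close>, this sequence \<open>S\<close>-converges to \<open>0\<close> with order \<open>\<beta>\<close>. No
  \<open>Y\<close> is an \<open>N\<close>-limit of order \<open>\<alpha>\<close>: every outcome of \<open>Y\<close> is at distance at least \<open>1/2\<close> from \<open>0\<close> or
  from \<open>1\<close>, so the two deviation probabilities add up to at least \<open>1\<close>, and as eventually
  \<open>2 * m \<le> h\<close>, the block sums are at least \<open>m \<ge> h powr \<alpha>\<close>.\<close>

lemma finite_block [simp]: "finite (block \<theta> r)"
  by (simp add: block_def)

lemma card_block [simp]: "card (block \<theta> r) = block_length \<theta> r"
  by (simp add: block_def block_length_def)

text \<open>Membership in block \<open>r\<close> gives \<theta> (r - 1) < k, and by monotonicity no
  \<open>s\<close> < \<open>r\<close> reaches \<open>k\<close>. So the block number is a function of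
  \<open>k\<close>, which lets a sequence be prescribed block by block.\<close>

lemma Least_block:
  assumes "strict_mono \<theta>" "k \<in> block \<theta> r"
  shows "(LEAST s. k \<le> \<theta> s) = r"
proof (rule Least_equality)
  show "k \<le> \<theta> r" using assms(2) by (simp add: block_def)
next
  fix s assume s: "k \<le> \<theta> s"
  show "r \<le> s"
  proof (rule ccontr)
    assume "\<not> r \<le> s"
    then have "\<theta> s \<le> \<theta> (r - 1)"
      using assms(1) by (simp add: strict_mono_less_eq)
    then show False using s assms(2) by (auto simp: block_def)
  qed
qed

lemma S_convergent_if_N_convergent:
  assumes "lacunary \<theta>" "\<alpha> \<le> \<beta>" and N: "N_convergent_in_prob M \<theta> \<alpha> X Y"
  shows "S_convergent_in_prob M \<theta> \<beta> X Y"
  unfolding S_convergent_in_prob_def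
proof (intro allI impI)
  fix \<epsilon> \<delta> :: real assume pos: "0 < \<epsilon>" "0 < \<delta>"
  define p where "p k = \<P>(x in M. \<bar>X k x - Y x\<bar> \<ge> \<epsilon>)" for k
  let ?h = "\<lambda>r. real (block_length \<theta> r)"
  let ?D = "\<lambda>r. {k \<in> block \<theta> r. p k \<ge> \<delta>}"
  have lim: "(\<lambda>r. (1 / ?h r powr \<alpha> * (\<Sum>k\<in>block \<theta> r. p k)) / \<delta>) \<longlonglongrightarrow> 0"
    using N pos tendsto_divide_zero unfolding N_convergent_in_prob_def p_def by blast
  \<comment> \<open>For bases at least 1, \<open>powr\<close> is monotone in the exponent; this is
    what allows passing from \<alpha> to \<beta>.\<close>
  have "\<forall>\<^sub>F r in sequentially. 1 \<le> block_length \<theta> r"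
    using assms(1) unfolding lacunary_def filterlim_at_top by blast
  then have le: "\<forall>\<^sub>F r in sequentially. 1 / ?h r powr \<beta> * real (card (?D r))
      \<le> (1 / ?h r powr \<alpha> * (\<Sum>k\<in>block \<theta> r. p k)) / \<delta>"
  proof eventually_elim
    case (elim r)
    \<comment> \<open>Markov's inequality: each index in \<open>?D r\<close> contributes at least
      \<delta> to the block sum.\<close>
    have "\<delta> * real (card (?D r)) = (\<Sum>k\<in>?D r. \<delta>)" by simp
    also have "\<dots> \<le> (\<Sum>k\<in>?D r. p k)" by (intro sum_mono) auto
    also have "\<dots> \<le> (\<Sum>k\<in>block \<theta> r. p k)"
      by (intro sum_mono2) (auto simp: p_def)
    finally have card: "real (card (?D r)) \<le> (\<Sum>k\<in>block \<theta> r. p k) / \<delta>"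
      using pos by (simp add: field_simps)
    have "?h r powr \<alpha> \<le> ?h r powr \<beta>" using elim assms(2) by (intro powr_mono) auto
    then have "1 / ?h r powr \<beta> \<le> 1 / ?h r powr \<alpha>" using elim by (intro divide_left_mono) auto
    from mult_mono[OF this card] show ?case by simp
  qed
  from tendsto_sandwich[OF _ le tendsto_const lim]
  have "(\<lambda>r. 1 / ?h r powr \<beta> * real (card (?D r))) \<longlonglongrightarrow> 0" by simp
  then show "(\<lambda>r. 1 / ?h r powr \<beta> *
      real (card {k \<in> block \<theta> r. \<P>(x in M. \<bar>X k x - Y x\<bar> \<ge> \<epsilon>) \<ge> \<delta>})) \<longlonglongrightarrow> 0"
    unfolding p_def .
qed

lemma PN_subset_PS:
  assumes "lacunary \<theta>" "\<alpha> \<le> \<beta>"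
  shows "PN M \<theta> \<alpha> \<subseteq> PS M \<theta> \<beta>"
  using S_convergent_if_N_convergent[OF assms] unfolding PN_def PS_def by blast

text \<open>The \<open>LEAST\<close> term is the number of the block containing \<open>k\<close>.
  The length \<open>m\<close> of the initial segments stays a parameter, to be fixed only in the
  main proof.\<close>

definition initial_indicator :: "(nat \<Rightarrow> nat) \<Rightarrow> (nat \<Rightarrow> nat) \<Rightarrow> nat \<Rightarrow> real" where
  "initial_indicator \<theta> m k =
     (let r = LEAST s. k \<le> \<theta> s in if k \<le> \<theta> (r - 1) + m r then 1 else 0)"

lemma initial_indicator_block:
  assumes "strict_mono \<theta>" "k \<in> block \<theta> r"
  shows "initial_indicator \<theta> m k = (if k \<le> \<theta> (r - 1) + m r then 1 else 0)"
  using Least_block[OF assms] by (simp add: initial_indicator_def)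

lemma S_convergent_initial_indicator:
  assumes "strict_mono \<theta>"
    and lim: "(\<lambda>r. real (m r) / real (block_length \<theta> r) powr \<beta>) \<longlonglongrightarrow> 0"
  shows "S_convergent_in_prob M \<theta> \<beta> (\<lambda>k x. initial_indicator \<theta> m k) (\<lambda>x. 0)"
  unfolding S_convergent_in_prob_def
proof (intro allI impI)
  fix \<epsilon> \<delta> :: real assume pos: "0 < \<epsilon>" "0 < \<delta>"
  let ?D = "\<lambda>r. {k \<in> block \<theta> r. \<P>(x in M. \<bar>initial_indicator \<theta> m k - 0\<bar> \<ge> \<epsilon>) \<ge> \<delta>}"
  have "card (?D r) \<le> m r" for r
  proof -
    \<comment> \<open>Beyond the initial segment the deviation is 0 < \<epsilon>, so the event is
      empty and its measure 0 is below \<delta>.\<close>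
    have "?D r \<subseteq> {\<theta> (r - 1)<..\<theta> (r - 1) + m r}"
      using pos by (auto simp: initial_indicator_block[OF assms(1)] block_def split: if_splits)
    from card_mono[OF _ this] show ?thesis by simp
  qed
  then show "(\<lambda>r. 1 / real (block_length \<theta> r) powr \<beta> * real (card (?D r))) \<longlonglongrightarrow> 0"
    by (intro tendsto_sandwich[OF _ _ tendsto_const lim] always_eventually allI)
      (auto intro!: divide_right_mono)
qed

lemma (in prob_space) deviation_from_0_or_1:
  assumes [measurable]: "Y \<in> borel_measurable M"
  shows "1 \<le> \<P>(x in M. \<bar>1 - Y x\<bar> \<ge> 1/2) + \<P>(x in M. \<bar>0 - Y x\<bar> \<ge> (1/2 :: real))"
proof -
  have "{x\<in>space M. \<bar>1 - Y x\<bar> \<ge> 1/2} \<union> {x\<in>space M. \<bar>0 - Y x\<bar> \<ge> 1/2} = space M"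
    by (auto simp: abs_if)
  then show ?thesis
    using measure_Un_le[of "{x\<in>space M. \<bar>1 - Y x\<bar> \<ge> 1/2}" M
        "{x\<in>space M. \<bar>0 - Y x\<bar> \<ge> 1/2}"]
    by (simp add: prob_space)
qed

text \<open>Membership in \<open>PN\<close> allows any limit, so every measurable \<open>Y\<close>
  has to be excluded, not just the constant 0.\<close>

lemma (in prob_space) not_N_convergent_initial_indicator:
  assumes "strict_mono \<theta>" and Y: "Y \<in> borel_measurable M"
    and large: "\<forall>\<^sub>F r in sequentially. 0 < block_length \<theta> r \<and>
      real (block_length \<theta> r) powr \<alpha> \<le> real (m r) \<and> 2 * m r \<le> block_length \<theta> r"
  shows "\<not> N_convergent_in_prob M \<theta> \<alpha> (\<lambda>k x. initial_indicator \<theta> m k) Y"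
proof
  let ?p = "\<lambda>k. \<P>(x in M. \<bar>initial_indicator \<theta> m k - Y x\<bar> \<ge> 1/2)"
  let ?s = "\<lambda>r. 1 / real (block_length \<theta> r) powr \<alpha> * (\<Sum>k\<in>block \<theta> r. ?p k)"
  define p where "p = \<P>(x in M. \<bar>0 - Y x\<bar> \<ge> 1/2)"
  define q where "q = \<P>(x in M. \<bar>1 - Y x\<bar> \<ge> 1/2)"
  have pq: "0 \<le> p" "1 \<le> q + p"
    using deviation_from_0_or_1[OF Y] unfolding p_def q_def by simp_all
  assume "N_convergent_in_prob M \<theta> \<alpha> (\<lambda>k x. initial_indicator \<theta> m k) Y"
  then have "?s \<longlonglongrightarrow> 0"
    unfolding N_convergent_in_prob_def by (elim allE[of _ "1/2"] impE) simp_all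
  then have "\<forall>\<^sub>F r in sequentially. ?s r < 1"
    by (rule order_tendstoD) simp
  with large have "\<forall>\<^sub>F r in sequentially. False"
  proof eventually_elim
    case (elim r)
    let ?A = "{\<theta> (r - 1)<..\<theta> (r - 1) + m r}" and ?B = "{\<theta> (r - 1) + m r<..\<theta> r}"
    \<comment> \<open>\<open>?B\<close> has h - m elements, where h is the block length and m is
      \<open>m r\<close>; 2 * m \<le> h makes this at least m.\<close>
    have split: "block \<theta> r = ?A \<union> ?B" and B: "m r \<le> card ?B"
      using elim by (auto simp: block_def block_length_def)
    have "initial_indicator \<theta> m k = 1" if "k \<in> ?A" for k
      using that split initial_indicator_block[OF assms(1), of k r] by auto
    then have "(\<Sum>k\<in>?A. ?p k) = (\<Sum>k\<in>?A. q)"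
      unfolding q_def by (intro sum.cong refl) simp
    moreover have "initial_indicator \<theta> m k = 0" if "k \<in> ?B" for k
      using that split initial_indicator_block[OF assms(1), of k r] by auto
    then have "(\<Sum>k\<in>?B. ?p k) = (\<Sum>k\<in>?B. p)"
      unfolding p_def by (intro sum.cong refl) simp
    moreover have "(\<Sum>k\<in>block \<theta> r. ?p k) = (\<Sum>k\<in>?A. ?p k) + (\<Sum>k\<in>?B. ?p k)"
      unfolding split by (intro sum.union_disjoint) auto
    ultimately have sum: "(\<Sum>k\<in>block \<theta> r. ?p k) = real (m r) * q + real (card ?B) * p"
      by simp
    \<comment> \<open>Each of the \<open>m r\<close> ones is paired with a zero of the same block,
      and each pair contributes q + p \<ge> 1.\<close>
    have "real (m r) * 1 \<le> real (m r) * (q + p)"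
      using pq by (intro mult_left_mono) auto
    also have "\<dots> \<le> (\<Sum>k\<in>block \<theta> r. ?p k)"
      unfolding sum using B pq by (simp add: distrib_left mult_right_mono del: card_greaterThanAtMost)
    finally have "real (block_length \<theta> r) powr \<alpha> \<le> (\<Sum>k\<in>block \<theta> r. ?p k)"
      using elim by linarith
    then have "1 \<le> ?s r" using elim by (simp add: divide_simps)
    then show False using elim by linarith
  qed
  then show False by simp
qed

lemma ceiling_powr_over_powr_tendsto_0:
  fixes \<alpha> \<beta> :: real
  assumes "0 < \<alpha>" "\<alpha> < \<beta>"
  shows "(\<lambda>n. real (nat \<lceil>real n powr \<alpha>\<rceil>) / real n powr \<beta>) \<longlonglongrightarrow> 0"
proof (rule tendsto_sandwich[OF _ _ tendsto_const])
  have "real (nat \<lceil>real n powr \<alpha>\<rceil>) \<le> real n powr \<alpha> + 1" for n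
    using powr_ge_zero[of "real n" \<alpha>] by linarith
  then show "\<forall>\<^sub>F n in sequentially.
      real (nat \<lceil>real n powr \<alpha>\<rceil>) / real n powr \<beta> \<le> (real n powr \<alpha> + 1) / real n powr \<beta>"
    by (intro always_eventually allI divide_right_mono) auto
  show "(\<lambda>n. (real n powr \<alpha> + 1) / real n powr \<beta>) \<longlonglongrightarrow> 0"
    using assms by real_asymp
qed (intro always_eventually allI divide_nonneg_nonneg of_nat_0_le_iff powr_ge_zero)

theorem theorem3p2:
  fixes M :: "'a measure" and \<theta> :: "nat \<Rightarrow> nat" and \<alpha> \<beta> :: real
  assumes "prob_space M"
    and "lacunary \<theta>"
    and "0 < \<alpha>" and "\<alpha> \<le> \<beta>" and "\<beta> \<le> 1"
  shows "PN M \<theta> \<alpha> \<subseteq> PS M \<theta> \<beta> \<and> (\<alpha> < \<beta> \<longrightarrow> PN M \<theta> \<alpha> \<subset> PS M \<theta> \<beta>)"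
proof (intro conjI impI)
  show incl: "PN M \<theta> \<alpha> \<subseteq> PS M \<theta> \<beta>"
    using assms by (intro PN_subset_PS)
  assume "\<alpha> < \<beta>"
  interpret prob_space M by fact
  have \<theta>: "strict_mono \<theta>" and h: "filterlim (block_length \<theta>) at_top sequentially"
    using assms(2) by (auto simp: lacunary_def)
  define m where "m r = nat \<lceil>real (block_length \<theta> r) powr \<alpha>\<rceil>" for r
  let ?X = "\<lambda>k (x :: 'a). initial_indicator \<theta> m k"
  \<comment> \<open>The exponent \<gamma> is left free for two uses: \<gamma> = 1 (as \<alpha> <
    \<beta> \<le> 1) shows that the ones eventually fill less than half of a block, and \<gamma> =
    \<beta> gives the \<open>S\<close>-convergence.\<close>
  have lim: "(\<lambda>r. real (m r) / real (block_length \<theta> r) powr \<gamma>) \<longlonglongrightarrow> 0" if "\<alpha> < \<gamma>" for \<gamma>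
    unfolding m_def
    by (rule filterlim_compose[OF ceiling_powr_over_powr_tendsto_0[OF assms(3) that] h])
  have "\<forall>\<^sub>F r in sequentially. real (m r) / real (block_length \<theta> r) powr 1 < 1/2"
    using \<open>\<alpha> < \<beta>\<close> assms(5) by (intro order_tendstoD(2)[OF lim]) auto
  moreover have "\<forall>\<^sub>F r in sequentially. 0 < block_length \<theta> r"
    using h by (auto simp: filterlim_at_top Suc_le_eq dest: spec[of _ 1])
  ultimately have "\<forall>\<^sub>F r in sequentially. 0 < block_length \<theta> r \<and>
      real (block_length \<theta> r) powr \<alpha> \<le> real (m r) \<and> 2 * m r \<le> block_length \<theta> r"
  proof eventually_elim
    case (elim r)
    then have "2 * m r < block_length \<theta> r" by (simp add: field_simps)
    moreover have "real (block_length \<theta> r) powr \<alpha> \<le> real (m r)"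
      unfolding m_def by linarith
    ultimately show ?case using elim by simp
  qed
  then have "?X \<notin> PN M \<theta> \<alpha>"
    using not_N_convergent_initial_indicator[OF \<theta>] by (auto simp: PN_def)
  moreover have "?X \<in> PS M \<theta> \<beta>"
    unfolding PS_def rv_sequence_def
    using S_convergent_initial_indicator[OF \<theta> lim[OF \<open>\<alpha> < \<beta>\<close>]]
    by (auto intro!: bexI[of _ "\<lambda>x. 0"])
  ultimately show "PN M \<theta> \<alpha> \<subset> PS M \<theta> \<beta>"
    using incl by blast
qed

end
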